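(* Let $G$ be a connected simple graph that is not isomorphic to any of the graphs $K_{2,l}$ ($l \geq 2$), $W_4$, $E_2 \vee C_4$, $2K_2$, $P_5$, the hammer, and the butterfly. Then $G$ is pseudo-split if and only if either (i) $G/e$ is split for every $e \in E(G)$, or (ii) $V(G)$ can be partitioned into three sets $A, B, C$ such that $A$ induces a clique, $B$ induces an independent set, $C$ induces $C_5$, every vertex of $A$ is adjacent to every vertex of $C$, and there are no edges between $B$ and $C$.
   Context: A graph is pseudo-split if it is $(2K_2, C_4)$-free, i.e. has no induced subgraph isomorphic to $2K_2$ (two vertex-disjoint edges) or to $C_4$. A graph is split if its vertex set can be partitioned into a clique and an independent set. $C_n$, $E_n$ denote the cycle and edgeless graph on $n$ vertices; $K_{2,l}$ is the complete bipartite graph with parts of sizes $2$ and $l$; $G\vee H$ is obtained from disjoint $G\cup H$ by adding all edges between $V(G)$ and $V(H)$; $W_4=K_1\vee C_4$; $P_5$ is the path on $5$ vertices. The hammer is the graph on vertices $a,b,x,c,d$ with edges $ab, bx, xc, cd, dx$. The butterfly is the graph on $5$ vertices consisting of two triangles sharing exactly one vertex. For an edge $e=uv$, the graph $G/e$ is obtained from $G$ by adding an edge between $u$ and every neighbour of $v$, then deleting $v$, removing loops and replacing multiple edges by single edges. *)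

theory Defs
  imports "Graph_Theory.Graph_Theory"
begin

text \<open>
  A finite simple graph is a \<^locale>\<open>pair_graph\<close>: a loop-free symmetric digraph whose arcs are ordered
  pairs of vertices. An undirected edge \<open>uv\<close> is thus represented by the two arcs \<open>(u, v)\<close>, \<open>(v, u)\<close>.
\<close>

abbreviation graph_iso :: "'a pair_pre_digraph \<Rightarrow> 'b pair_pre_digraph \<Rightarrow> bool" where
  "graph_iso G H \<equiv> digraph_iso (with_proj G) (with_proj H)"

definition induces :: "'a pair_pre_digraph \<Rightarrow> 'a set \<Rightarrow> 'b pair_pre_digraph \<Rightarrow> bool" where
  "induces G S H \<longleftrightarrow> S \<subseteq> pverts G \<and> digraph_iso (with_proj G \<restriction> S) (with_proj H)"

definition is_clique :: "'a pair_pre_digraph \<Rightarrow> 'a set \<Rightarrow> bool" where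
  "is_clique G A \<longleftrightarrow> A \<subseteq> pverts G \<and> (\<forall>u\<in>A. \<forall>v\<in>A. u \<noteq> v \<longrightarrow> (u, v) \<in> parcs G)"

definition is_independent :: "'a pair_pre_digraph \<Rightarrow> 'a set \<Rightarrow> bool" where
  "is_independent G B \<longleftrightarrow> B \<subseteq> pverts G \<and> (\<forall>u\<in>B. \<forall>v\<in>B. (u, v) \<notin> parcs G)"

definition graph_of_edges :: "'a set \<Rightarrow> ('a \<times> 'a) set \<Rightarrow> 'a pair_pre_digraph" where
  "graph_of_edges V E = \<lparr> pverts = V, parcs = E \<union> E\<inverse> \<rparr>"

definition edgeless_graph :: "nat \<Rightarrow> nat pair_pre_digraph" where
  "edgeless_graph n = graph_of_edges {..<n} {}"

definition complete_graph :: "nat \<Rightarrow> nat pair_pre_digraph" where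
  "complete_graph n = graph_of_edges {..<n} {(i, j). i < j \<and> j < n}"

definition path_graph :: "nat \<Rightarrow> nat pair_pre_digraph" where
  "path_graph n = graph_of_edges {..<n} {(i, Suc i) | i. Suc i < n}"

text \<open>Meaningful for \<open>n \<ge> 3\<close> only.\<close>
definition cycle_graph :: "nat \<Rightarrow> nat pair_pre_digraph" where
  "cycle_graph n = graph_of_edges {..<n} {(i, Suc i mod n) | i. i < n}"

definition two_K2 :: "nat pair_pre_digraph" where
  "two_K2 = graph_of_edges {..<4} {(0, 1), (2, 3)}"

text \<open>The vertices \<open>a, b, x, c, d\<close> are numbered \<open>0, 1, 2, 3, 4\<close>.\<close>
definition hammer :: "nat pair_pre_digraph" where
  "hammer = graph_of_edges {..<5} {(0, 1), (1, 2), (2, 3), (3, 4), (4, 2)}"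

definition butterfly :: "nat pair_pre_digraph" where
  "butterfly = graph_of_edges {..<5} {(0, 1), (1, 2), (2, 0), (2, 3), (3, 4), (4, 2)}"

definition graph_join :: "'a pair_pre_digraph \<Rightarrow> 'b pair_pre_digraph \<Rightarrow> ('a + 'b) pair_pre_digraph" where
  "graph_join G H = graph_of_edges (pverts G <+> pverts H)
     (map_prod Inl Inl ` parcs G \<union> map_prod Inr Inr ` parcs H \<union> Inl ` pverts G \<times> Inr ` pverts H)"

definition wheel4 :: "(nat + nat) pair_pre_digraph" where
  "wheel4 = graph_join (complete_graph 1) (cycle_graph 4)"

definition pseudo_split :: "'a pair_pre_digraph \<Rightarrow> bool" where
  "pseudo_split G \<longleftrightarrow> \<not> (\<exists>S. induces G S two_K2) \<and> \<not> (\<exists>S. induces G S (cycle_graph 4))"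

definition split_graph :: "'a pair_pre_digraph \<Rightarrow> bool" where
  "split_graph G \<longleftrightarrow>
     (\<exists>A B. A \<union> B = pverts G \<and> A \<inter> B = {} \<and> is_clique G A \<and> is_independent G B)"

text \<open>
  The contraction \<open>G/e\<close> for \<open>e = (u, v)\<close>: join \<open>u\<close> to all neighbours of \<open>v\<close>, then drop \<open>v\<close>, all arcs
  at \<open>v\<close> and all loops. Contracting \<open>(v, u)\<close> keeps \<open>v\<close> instead of \<open>u\<close>, giving an isomorphic graph.
\<close>
definition contract_edge :: "'a pair_pre_digraph \<Rightarrow> 'a \<times> 'a \<Rightarrow> 'a pair_pre_digraph" where
  "contract_edge G e = (case e of (u, v) \<Rightarrow>
     let N = {w. (v, w) \<in> parcs G} in
       \<lparr> pverts = pverts G - {v},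
         parcs = {(x, y) \<in> parcs G \<union> {u} \<times> N \<union> N \<times> {u}. x \<noteq> v \<and> y \<noteq> v \<and> x \<noteq> y} \<rparr>)"

end

theory Submission
  imports Defs
begin

text \<open>
  A maximum clique of maximum degree sum shows that a \<open>(2K\<^sub>2, C\<^sub>4)\<close>-free graph is split or contains an
  induced \<open>C\<^sub>5\<close>; in the latter case every vertex off the \<open>C\<^sub>5\<close> is adjacent to all or to none of
  it. Splitness passes to contractions, which gives one direction.

  Conversely, suppose all contractions are split and \<open>S\<close> induces a \<open>2K\<^sub>2\<close> or \<open>C\<^sub>4\<close>. Contracting an edge
  disjoint from \<open>S\<close> would preserve \<open>S\<close>, so the vertices outside \<open>S\<close> are independent; contracting an
  edge \<open>wa\<close> with \<open>a \<in> S\<close> restricts the neighbours of \<open>w\<close> in \<open>S\<close>. For a \<open>2K\<^sub>2\<close> exactly one outside vertex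
  remains, adjacent to both edges. For a \<open>C\<^sub>4\<close>, either all outside vertices see the same two opposite
  vertices, giving \<open>K\<^sub>2\<^sub>,\<^sub>l\<close>, or at most two of them exist and they see the whole cycle.
\<close>

section \<open>Induced subgraphs as embeddings\<close>

text \<open>The inverse of an isomorphism is read as an embedding of \<open>H\<close> into
  \<open>G\<close>. This reduces every later question about induced subgraphs to adjacency of named
  vertices.\<close>

lemma inducesE:
  assumes "induces G S H"
  obtains f where "bij_betw f (pverts H) S" "S \<subseteq> pverts G"
    "\<And>x y. x \<in> pverts H \<Longrightarrow> y \<in> pverts H \<Longrightarrow> (f x, f y) \<in> parcs G \<longleftrightarrow> (x, y) \<in> parcs H"
proof -
  let ?E = "{e \<in> parcs G. fst e \<in> S \<and> snd e \<in> S}"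
  obtain h where h: "pre_digraph.digraph_isomorphism (with_proj G \<restriction> S) h"
    and H: "with_proj H = app_iso h (with_proj G \<restriction> S)" and S: "S \<subseteq> pverts G"
    using assms unfolding induces_def digraph_iso_def by blast
  define g where "g = iso_verts h"
  have inj: "inj_on g S"
    using h by (simp add: pre_digraph.digraph_isomorphism_def g_def)
  have V: "pverts H = g ` S"
    using arg_cong[OF H, of verts] by (simp add: g_def)
  have A: "parcs H = iso_arcs h ` ?E"
    using arg_cong[OF H, of arcs] by simp
  have ends: "iso_tail h = fst" "iso_head h = snd"
    using arg_cong[OF H, of tail] arg_cong[OF H, of head] by simp_all
  \<comment> \<open>The arc map has no freedom: it commutes with tail and head, and in
    \<open>H\<close> these are the two projections of a pair.\<close>
  have "iso_arcs h e = map_prod g g e" if "e \<in> ?E" for e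
  proof -
    have "g (fst e) = fst (iso_arcs h e) \<and> g (snd e) = snd (iso_arcs h e)"
      using h that unfolding pre_digraph.digraph_isomorphism_def ends g_def by (cases e) simp
    then show ?thesis
      by (simp add: prod_eq_iff)
  qed
  then have A': "parcs H = map_prod g g ` ?E"
    unfolding A by (rule image_cong[OF refl])
  define f where "f = inv_into S g"
  have "bij_betw f (pverts H) S"
    unfolding f_def V using inj by (simp add: bij_betw_inv_into inj_on_imp_bij_betw)
  moreover have "(f x, f y) \<in> parcs G \<longleftrightarrow> (x, y) \<in> parcs H"
    if "x \<in> pverts H" "y \<in> pverts H" for x y
  proof -
    obtain u v where uv: "u \<in> S" "v \<in> S" and xy: "x = g u" "y = g v"
      using \<open>x \<in> _\<close> \<open>y \<in> _\<close> unfolding V by blast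
    have f: "f x = u" "f y = v"
      using inj uv by (simp_all add: f_def xy)
    have "(x, y) \<in> parcs H \<longleftrightarrow> (\<exists>a\<in>S. \<exists>b\<in>S. (a, b) \<in> parcs G \<and> g u = g a \<and> g v = g b)"
      unfolding A' xy by force
    also have "\<dots> \<longleftrightarrow> (u, v) \<in> parcs G"
      using uv inj_on_eq_iff[OF inj] by blast
    finally show ?thesis
      unfolding f by simp
  qed
  ultimately show thesis
    using S by (intro that)
qed

text \<open>The converse of \<open>inducesE\<close>: only a vertex map is needed, since its product
  with itself serves as the arc map. By \<open>wf\<close>, every arc of \<open>H\<close> is the
  image of an arc inside \<open>S\<close>.\<close>

lemma inducesI:
  assumes bij: "bij_betw f (pverts H) S" and S: "S \<subseteq> pverts G"
    and wf: "parcs H \<subseteq> pverts H \<times> pverts H"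
    and iff: "\<And>x y. x \<in> pverts H \<Longrightarrow> y \<in> pverts H \<Longrightarrow> (f x, f y) \<in> parcs G \<longleftrightarrow> (x, y) \<in> parcs H"
  shows "induces G S H"
proof -
  define g where "g = inv_into (pverts H) f"
  have g: "bij_betw g S (pverts H)"
    unfolding g_def by (rule bij_betw_inv_into[OF bij])
  have gf: "g (f x) = x" if "x \<in> pverts H" for x
    using that bij by (simp add: g_def bij_betw_def)
  have fg: "f (g u) = u" "g u \<in> pverts H" if "u \<in> S" for u
    using that bij g by (auto simp: g_def bij_betw_inv_into_right bij_betw_def inv_into_into)
  let ?h = "\<lparr> iso_verts = g, iso_arcs = map_prod g g, iso_head = snd, iso_tail = fst \<rparr>"
  have "wf_digraph (with_proj G \<restriction> S)"
    by unfold_locales auto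
  moreover have "inj_on g S"
    using g by (simp add: bij_betw_def)
  moreover have "inj_on (map_prod g g) (S \<times> S)"
    using map_prod_inj_on[OF \<open>inj_on g S\<close> \<open>inj_on g S\<close>] .
  then have "inj_on (map_prod g g) {e \<in> parcs G. fst e \<in> S \<and> snd e \<in> S}"
    by (rule inj_on_subset) auto
  ultimately have "pre_digraph.digraph_isomorphism (with_proj G \<restriction> S) ?h"
    by (auto simp: pre_digraph.digraph_isomorphism_def)
  moreover have "parcs H = map_prod g g ` {e \<in> parcs G. fst e \<in> S \<and> snd e \<in> S}"
  proof (intro set_eqI iffI)
    fix e assume e: "e \<in> parcs H"
    obtain x y where xy: "e = (x, y)" "x \<in> pverts H" "y \<in> pverts H"
      using e wf by (cases e) auto
    have "(f x, f y) \<in> {e \<in> parcs G. fst e \<in> S \<and> snd e \<in> S}"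
      using iff[of x y] xy e bij by (auto simp: bij_betw_def)
    moreover have "e = map_prod g g (f x, f y)"
      using xy gf by simp
    ultimately show "e \<in> map_prod g g ` {e \<in> parcs G. fst e \<in> S \<and> snd e \<in> S}"
      by blast
  next
    fix e assume "e \<in> map_prod g g ` {e \<in> parcs G. fst e \<in> S \<and> snd e \<in> S}"
    then obtain u v where "e = (g u, g v)" "(u, v) \<in> parcs G" "u \<in> S" "v \<in> S"
      by auto
    then show "e \<in> parcs H"
      using iff[of "g u" "g v"] fg[of u] fg[of v] by simp
  qed
  then have "with_proj H = app_iso ?h (with_proj G \<restriction> S)"
    using g by (simp add: app_iso_def with_proj_def bij_betw_def induce_subgraph_def)
  ultimately show ?thesis
    using S by (auto simp: induces_def digraph_iso_def)
qed

lemma (in pair_wf_digraph) graph_iso_if_induces: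
  assumes "induces G (pverts G) H"
  shows "graph_iso G H"
proof -
  have "with_proj G \<restriction> pverts G = with_proj G"
    by (auto simp: induce_subgraph_def with_proj_def dest: in_arcsD1 in_arcsD2)
  then show ?thesis
    using assms by (simp add: induces_def)
qed

section \<open>Vertices and arcs of the concrete graphs\<close>

lemma cycle_graph_simps:
  "pverts (cycle_graph n) = {..<n}"
  "(i, j) \<in> parcs (cycle_graph n) \<longleftrightarrow> (i < n \<and> j = Suc i mod n) \<or> (j < n \<and> i = Suc j mod n)"
  by (auto simp: cycle_graph_def graph_of_edges_def)

lemma lessThan_4: "{..<4 :: nat} = {0, 1, 2, 3}"
  by auto

lemma lessThan_5: "{..<5 :: nat} = {0, 1, 2, 3, 4}"
  by auto

text \<open>An explicit list lets the simplifier decide adjacency of numeral indices without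
  computing remainders.\<close>

lemma parcs_cycle_graph_4:
  "parcs (cycle_graph 4) = {(0, 1), (1, 2), (2, 3), (3, 0), (1, 0), (2, 1), (3, 2), (0, 3)}"
proof -
  have "{(i, Suc i mod 4) | i. i < 4} = (\<lambda>i. (i, Suc i mod 4)) ` {..<4}"
    by blast
  also have "\<dots> = {(0, 1), (1, 2), (2, 3), (3, 0)}"
    unfolding lessThan_4 by (simp add: numeral_2_eq_2, simp add: numeral_3_eq_3)
  finally have edges: "{(i, Suc i mod 4) | i. i < 4} = {(0, 1), (1, 2), (2, 3), (3, 0)}" .
  show ?thesis
    unfolding cycle_graph_def graph_of_edges_def edges by auto
qed

lemma parcs_cycle_graph_5:
  "parcs (cycle_graph 5) =
    {(0, 1), (1, 2), (2, 3), (3, 4), (4, 0), (1, 0), (2, 1), (3, 2), (4, 3), (0, 4)}"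
proof -
  have "{(i, Suc i mod 5) | i. i < 5} = (\<lambda>i. (i, Suc i mod 5)) ` {..<5}"
    by blast
  also have "\<dots> = {(0, 1), (1, 2), (2, 3), (3, 4), (4, 0)}"
    unfolding lessThan_5 by (simp add: numeral_2_eq_2)
  finally have edges: "{(i, Suc i mod 5) | i. i < 5} = {(0, 1), (1, 2), (2, 3), (3, 4), (4, 0)}" .
  show ?thesis
    unfolding cycle_graph_def graph_of_edges_def edges by auto
qed

lemma path_graph_simps:
  "pverts (path_graph n) = {..<n}"
  "(i, j) \<in> parcs (path_graph n) \<longleftrightarrow> (j = Suc i \<and> j < n) \<or> (i = Suc j \<and> i < n)"
  by (auto simp: path_graph_def graph_of_edges_def)

lemma pverts_graph_join: "pverts (graph_join G H) = pverts G <+> pverts H"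
  by (simp add: graph_join_def graph_of_edges_def)

lemma parcs_graph_join:
  "(Inl i, Inl j) \<in> parcs (graph_join G H) \<longleftrightarrow> (i, j) \<in> parcs G \<or> (j, i) \<in> parcs G"
  "(Inr k, Inr l) \<in> parcs (graph_join G H) \<longleftrightarrow> (k, l) \<in> parcs H \<or> (l, k) \<in> parcs H"
  "(Inl i, Inr k) \<in> parcs (graph_join G H) \<longleftrightarrow> i \<in> pverts G \<and> k \<in> pverts H"
  "(Inr k, Inl i) \<in> parcs (graph_join G H) \<longleftrightarrow> i \<in> pverts G \<and> k \<in> pverts H"
  by (force simp: graph_join_def graph_of_edges_def)+

lemma edgeless_graph_simps: "pverts (edgeless_graph n) = {..<n}" "parcs (edgeless_graph n) = {}"
  by (simp_all add: edgeless_graph_def graph_of_edges_def)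

lemma pair_graph_graph_of_edges:
  assumes "finite V" "F \<subseteq> V \<times> V" "\<And>x. (x, x) \<notin> F"
  shows "pair_graph (graph_of_edges V F)"
proof -
  have "finite F"
    using assms(1,2) finite_subset by blast
  then show ?thesis
    using assms unfolding graph_of_edges_def
    by unfold_locales (auto simp: symmetric_def sym_def)
qed

lemma cycle_graph_pair_graph: "n \<ge> 2 \<Longrightarrow> pair_graph (cycle_graph n)"
  unfolding cycle_graph_def by (rule pair_graph_graph_of_edges) (auto simp: mod_Suc split: if_splits intro!: gr0I)

lemma path_graph_pair_graph: "pair_graph (path_graph n)"
  unfolding path_graph_def by (rule pair_graph_graph_of_edges) auto

lemma hammer_pair_graph: "pair_graph hammer"
  unfolding hammer_def by (rule pair_graph_graph_of_edges) auto

lemma butterfly_pair_graph: "pair_graph butterfly"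
  unfolding butterfly_def by (rule pair_graph_graph_of_edges) auto

lemma two_K2_pair_graph: "pair_graph two_K2"
  unfolding two_K2_def by (rule pair_graph_graph_of_edges) auto

section \<open>Induced subgraphs expressed by adjacency of named vertices\<close>

context pair_graph
begin

abbreviation adj (infix "\<sim>" 50) where "u \<sim> v \<equiv> (u, v) \<in> parcs G"

lemma adj_sym: "u \<sim> v \<longleftrightarrow> v \<sim> u"
  using arcs_symmetric by blast

lemma adj_irrefl: "\<not> u \<sim> u"
  using no_loops'[of u u] by auto

lemma adj_verts: "u \<sim> v \<Longrightarrow> u \<in> pverts G" "u \<sim> v \<Longrightarrow> v \<in> pverts G"
  using wellformed' by auto

text \<open>The list position of a vertex is its number in \<open>H\<close>. Pairs with
  \<open>i < j\<close> suffice because both graphs are symmetric and loop-free.\<close>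

lemma induces_set_listI:
  assumes "pverts H = {..<length xs}" "pair_graph H"
    and "distinct xs" "set xs \<subseteq> pverts G"
    and *: "\<forall>j<length xs. \<forall>i<j. xs ! i \<sim> xs ! j \<longleftrightarrow> (i, j) \<in> parcs H"
  shows "induces G (set xs) H"
proof (rule inducesI[where f = "(!) xs"])
  interpret H: pair_graph H by fact
  show "parcs H \<subseteq> pverts H \<times> pverts H"
    using H.adj_verts by auto
  fix i j assume "i \<in> pverts H" "j \<in> pverts H"
  then have "i < length xs" "j < length xs"
    using assms by auto
  then show "xs ! i \<sim> xs ! j \<longleftrightarrow> (i, j) \<in> parcs H"
    using * adj_sym[of "xs ! i"] H.adj_sym[of i] adj_irrefl H.adj_irrefl
    by (cases i j rule: linorder_cases) auto
qed (use assms bij_betw_nth[of xs] in auto)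

text \<open>Distinctness is implied: \<open>a = c\<close>, for instance, would turn
  \<open>c \<sim> d\<close> into the excluded \<open>a \<sim> d\<close>.\<close>

definition twoK2 where
  "twoK2 a b c d \<longleftrightarrow> a \<sim> b \<and> c \<sim> d \<and> \<not> a \<sim> c \<and> \<not> a \<sim> d \<and> \<not> b \<sim> c \<and> \<not> b \<sim> d"

text \<open>Opposite vertices must be kept apart explicitly: a single edge walked back and forth
  satisfies all the other clauses.\<close>

definition C4 where
  "C4 a b c d \<longleftrightarrow> a \<sim> b \<and> b \<sim> c \<and> c \<sim> d \<and> d \<sim> a \<and> \<not> a \<sim> c \<and> \<not> b \<sim> d \<and> a \<noteq> c \<and> b \<noteq> d"

definition C5 where
  "C5 a b c d e \<longleftrightarrow> a \<sim> b \<and> b \<sim> c \<and> c \<sim> d \<and> d \<sim> e \<and> e \<sim> a \<and>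
    \<not> a \<sim> c \<and> \<not> b \<sim> d \<and> \<not> c \<sim> e \<and> \<not> d \<sim> a \<and> \<not> e \<sim> b"

lemma induces_two_K2_iff: "(\<exists>S. induces G S two_K2) \<longleftrightarrow> (\<exists>a b c d. twoK2 a b c d)"
proof
  assume "\<exists>S. induces G S two_K2"
  then obtain S where S: "induces G S two_K2" by blast
  obtain f where bij: "bij_betw f (pverts two_K2) S" and "S \<subseteq> pverts G"
    and f: "\<And>x y. x \<in> pverts two_K2 \<Longrightarrow> y \<in> pverts two_K2 \<Longrightarrow>
      f x \<sim> f y \<longleftrightarrow> (x, y) \<in> parcs two_K2"
    by (rule inducesE[OF S], rule that) auto
  have "twoK2 (f 0) (f 1) (f 2) (f 3)"
    unfolding twoK2_def
    using f[of 0 1] f[of 2 3] f[of 0 2] f[of 0 3] f[of 1 2] f[of 1 3]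
    by (simp add: two_K2_def graph_of_edges_def)
  then show "\<exists>a b c d. twoK2 a b c d" by blast
next
  assume "\<exists>a b c d. twoK2 a b c d"
  then obtain a b c d where abcd: "twoK2 a b c d" by blast
  have ne: "a \<noteq> b" "a \<noteq> c" "a \<noteq> d" "b \<noteq> c" "b \<noteq> d" "c \<noteq> d"
    using abcd adj_irrefl adj_sym unfolding twoK2_def by metis+
  have "induces G (set [a, b, c, d]) two_K2"
  proof (rule induces_set_listI)
    show "distinct [a, b, c, d]"
      using ne by simp
    show "set [a, b, c, d] \<subseteq> pverts G"
      using abcd by (auto simp: twoK2_def dest: adj_verts)
    show "\<forall>j<length [a, b, c, d]. \<forall>i<j. [a, b, c, d] ! i \<sim> [a, b, c, d] ! j \<longleftrightarrow>
        (i, j) \<in> parcs two_K2"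
      using abcd unfolding twoK2_def
      by (simp add: two_K2_def graph_of_edges_def numeral_eq_Suc All_less_Suc)
  qed (use two_K2_pair_graph in \<open>simp_all add: two_K2_def graph_of_edges_def\<close>)
  then show "\<exists>S. induces G S two_K2" by blast
qed

lemma induces_C4I:
  assumes "C4 a b c d"
  shows "induces G {a, b, c, d} (cycle_graph 4)"
proof -
  have ne: "a \<noteq> b" "a \<noteq> c" "a \<noteq> d" "b \<noteq> c" "b \<noteq> d" "c \<noteq> d"
    using assms adj_irrefl by (auto simp: C4_def)
  have "induces G (set [a, b, c, d]) (cycle_graph 4)"
  proof (rule induces_set_listI)
    show "distinct [a, b, c, d]"
      using ne by simp
    show "set [a, b, c, d] \<subseteq> pverts G"
      using assms by (auto simp: C4_def dest: adj_verts)
    show "\<forall>j<length [a, b, c, d]. \<forall>i<j. [a, b, c, d] ! i \<sim> [a, b, c, d] ! j \<longleftrightarrow>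
        (i, j) \<in> parcs (cycle_graph 4)"
      using assms adj_sym[of d a] unfolding C4_def
      by (simp only: parcs_cycle_graph_4) (simp add: numeral_eq_Suc All_less_Suc)
  qed (simp_all add: cycle_graph_simps cycle_graph_pair_graph)
  then show ?thesis by simp
qed

lemma induces_C4_iff: "(\<exists>S. induces G S (cycle_graph 4)) \<longleftrightarrow> (\<exists>a b c d. C4 a b c d)"
proof
  assume "\<exists>S. induces G S (cycle_graph 4)"
  then obtain S where S: "induces G S (cycle_graph 4)" by blast
  obtain f where bij: "bij_betw f (pverts (cycle_graph 4)) S" and "S \<subseteq> pverts G"
    and f: "\<And>x y. x \<in> pverts (cycle_graph 4) \<Longrightarrow> y \<in> pverts (cycle_graph 4) \<Longrightarrow>
      f x \<sim> f y \<longleftrightarrow> (x, y) \<in> parcs (cycle_graph 4)"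
    by (rule inducesE[OF S], rule that) auto
  have "f 0 \<noteq> f 2" "f 1 \<noteq> f 3"
    using inj_onD[OF bij_betw_imp_inj_on[OF bij], of 0 2]
      inj_onD[OF bij_betw_imp_inj_on[OF bij], of 1 3]
    by (auto simp: cycle_graph_simps)
  then have "C4 (f 0) (f 1) (f 2) (f 3)"
    unfolding C4_def
    using f[of 0 1] f[of 1 2] f[of 2 3] f[of 3 0] f[of 0 2] f[of 1 3]
    by (simp add: cycle_graph_simps)
  then show "\<exists>a b c d. C4 a b c d" by blast
next
  assume "\<exists>a b c d. C4 a b c d"
  then show "\<exists>S. induces G S (cycle_graph 4)"
    using induces_C4I by blast
qed

lemma induces_C5I:
  assumes "C5 a b c d e"
  shows "induces G {a, b, c, d, e} (cycle_graph 5)"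
proof -
  have sym: "a \<sim> e" "\<not> a \<sim> d" "\<not> b \<sim> e" "b \<sim> a" "c \<sim> b" "d \<sim> c" "e \<sim> d"
    using assms adj_sym by (auto simp: C5_def)
  have ne: "a \<noteq> b" "a \<noteq> c" "a \<noteq> d" "a \<noteq> e" "b \<noteq> c" "b \<noteq> d" "b \<noteq> e" "c \<noteq> d" "c \<noteq> e" "d \<noteq> e"
    using assms sym adj_irrefl[of a] adj_irrefl[of b] adj_irrefl[of c] adj_irrefl[of d] adj_irrefl[of e]
    by (auto simp: C5_def)
  have "induces G (set [a, b, c, d, e]) (cycle_graph 5)"
  proof (rule induces_set_listI)
    show "distinct [a, b, c, d, e]"
      using ne by simp
    show "set [a, b, c, d, e] \<subseteq> pverts G"
      using assms by (auto simp: C5_def dest: adj_verts)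
    show "\<forall>j<length [a, b, c, d, e]. \<forall>i<j. [a, b, c, d, e] ! i \<sim> [a, b, c, d, e] ! j \<longleftrightarrow>
        (i, j) \<in> parcs (cycle_graph 5)"
      using assms sym unfolding C5_def
      by (simp only: parcs_cycle_graph_5) (simp add: numeral_eq_Suc All_less_Suc)
  qed (simp_all add: cycle_graph_simps cycle_graph_pair_graph)
  then show ?thesis by simp
qed

lemma induces_C5E:
  assumes "induces G S (cycle_graph 5)"
  obtains a b c d e where "C5 a b c d e" "S = {a, b, c, d, e}"
proof -
  obtain f where bij: "bij_betw f (pverts (cycle_graph 5)) S" and "S \<subseteq> pverts G"
    and f: "\<And>x y. x \<in> pverts (cycle_graph 5) \<Longrightarrow> y \<in> pverts (cycle_graph 5) \<Longrightarrow>
      f x \<sim> f y \<longleftrightarrow> (x, y) \<in> parcs (cycle_graph 5)"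
    by (rule inducesE[OF assms], rule that) auto
  have "S = f ` {0, 1, 2, 3, 4}"
    using bij_betw_imp_surj_on[OF bij]
    unfolding cycle_graph_simps lessThan_5 by simp
  then have "S = {f 0, f 1, f 2, f 3, f 4}"
    by simp
  moreover have "C5 (f 0) (f 1) (f 2) (f 3) (f 4)"
    unfolding C5_def
    using f[of 0 1] f[of 1 2] f[of 2 3] f[of 3 4] f[of 4 0]
      f[of 0 2] f[of 1 3] f[of 2 4] f[of 3 0] f[of 4 1]
    by (simp add: cycle_graph_simps)
  ultimately show thesis using that by blast
qed


text \<open>Covers \<open>W_4\<close> and \<open>E_2 \<or> C_4\<close> (join) at once, because
  \<open>K_1\<close> is \<open>E_1\<close>. The isomorphism glues the enumeration \<open>xs\<close>
  to an embedding of the cycle.\<close>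

lemma graph_iso_join_edgeless_C4:
  assumes "C4 a b c d" and xs: "distinct xs" "set xs \<inter> {a, b, c, d} = {}" "pverts G = set xs \<union> {a, b, c, d}"
    and indep: "\<And>u v. u \<in> set xs \<Longrightarrow> v \<in> set xs \<Longrightarrow> \<not> u \<sim> v"
    and full: "\<And>u v. u \<in> set xs \<Longrightarrow> v \<in> {a, b, c, d} \<Longrightarrow> u \<sim> v"
  shows "graph_iso G (graph_join (edgeless_graph (length xs)) (cycle_graph 4))"
proof (rule graph_iso_if_induces)
  let ?H = "graph_join (edgeless_graph (length xs)) (cycle_graph 4)"
  obtain g where g: "bij_betw g (pverts (cycle_graph 4)) {a, b, c, d}" and "{a, b, c, d} \<subseteq> pverts G"
    and g_iff: "\<And>x y. x \<in> pverts (cycle_graph 4) \<Longrightarrow> y \<in> pverts (cycle_graph 4) \<Longrightarrow>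
      g x \<sim> g y \<longleftrightarrow> (x, y) \<in> parcs (cycle_graph 4)"
    by (rule inducesE[OF induces_C4I[OF assms(1)]], rule that) auto
  define f where "f = case_sum (\<lambda>i. xs ! i) g"
  have f_simps: "f (Inl i) = xs ! i" "f (Inr k) = g k" for i k
    by (simp_all add: f_def)
  have g_mem: "g k \<in> {a, b, c, d}" if "k \<in> pverts (cycle_graph 4)" for k
    using g that unfolding bij_betw_def by blast
  have full': "v \<sim> u" if "u \<in> set xs" "v \<in> {a, b, c, d}" for u v
    using full[OF that] adj_sym by blast
  interpret C: pair_graph "cycle_graph 4"
    by (rule cycle_graph_pair_graph) simp
  have "inj_on f (pverts ?H)"
  proof (rule inj_onI)
    fix x y assume "x \<in> pverts ?H" "y \<in> pverts ?H" "f x = f y"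
    then show "x = y"
      using g_mem xs(1,2) inj_onD[OF bij_betw_imp_inj_on[OF g]] nth_mem[of _ xs] nth_eq_iff_index_eq[of xs]
      unfolding pverts_graph_join edgeless_graph_simps
      by (elim PlusE) (auto simp only: f_simps lessThan_iff disjoint_iff, metis+)
  qed
  moreover have "f ` pverts ?H = pverts G"
  proof -
    have "(!) xs ` {..<length xs} = set xs"
      by (auto simp: set_conv_nth)
    then show ?thesis
      using g unfolding pverts_graph_join edgeless_graph_simps Plus_def xs(3) bij_betw_def
      by (simp add: image_Un image_image f_simps)
  qed
  ultimately have bij: "bij_betw f (pverts ?H) (pverts G)"
    by (simp add: bij_betw_def)
  show "induces G (pverts G) ?H"
  proof (rule inducesI[OF bij])
    show "parcs ?H \<subseteq> pverts ?H \<times> pverts ?H"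
      unfolding graph_join_def graph_of_edges_def edgeless_graph_simps
      using C.adj_verts by auto
    fix x y assume "x \<in> pverts ?H" "y \<in> pverts ?H"
    then show "f x \<sim> f y \<longleftrightarrow> (x, y) \<in> parcs ?H"
      using indep full[OF _ g_mem] full'[OF _ g_mem] g_iff C.adj_sym
      unfolding pverts_graph_join
      by (elim PlusE) (simp_all add: f_simps parcs_graph_join edgeless_graph_simps)
  qed simp
qed

section \<open>The pseudo-split structure theorem\<close>

lemma C5_rotate: "C5 a b c d e \<Longrightarrow> C5 b c d e a"
  by (simp add: C5_def adj_sym)

text \<open>If some edge \<open>xy\<close> avoids the chosen clique \<open>K\<close>, then either
  the non-neighbours of \<open>x\<close> and \<open>y\<close> in \<open>K\<close> are nested, which
  forces a \<open>C5\<close>, or each of \<open>x\<close>, \<open>y\<close> has a neighbour in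
  \<open>K\<close> missed by the other, which gives a \<open>C4\<close>. So the complement of
  \<open>K\<close> is independent.\<close>

lemma split_or_C5:
  assumes no2K2: "\<And>a b c d. \<not> twoK2 a b c d" and noC4: "\<And>a b c d. \<not> C4 a b c d"
  shows "split_graph G \<or> (\<exists>a b c d e. C5 a b c d e)"
proof (rule ccontr)
  assume asm: "\<not> ?thesis"
  define N where "N v = {w. v \<sim> w}" for v
  have finN: "finite (N v)" for v
    using pair_finite_verts by (rule finite_subset[rotated]) (auto simp: N_def dest: adj_verts)
  let ?cliques = "{K. is_clique G K}"
  have fin: "finite ?cliques"
    using pair_finite_verts by (rule finite_subset[of _ "Pow (pverts G)", rotated, OF finite_Pow_iff[THEN iffD2]])
      (auto simp: is_clique_def)
  have "is_clique G {}"
    by (simp add: is_clique_def)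
  define m where "m = Max (card ` ?cliques)"
  have m_ge: "card K \<le> m" if "is_clique G K" for K
    using fin that unfolding m_def by (intro Max_ge) auto
  let ?max = "{K. is_clique G K \<and> card K = m}"
  have finmax: "finite ?max"
    using fin by (rule finite_subset[rotated]) auto
  have "m \<in> card ` ?cliques"
    using fin \<open>is_clique G {}\<close> unfolding m_def by (intro Max_in) auto
  then have ne: "?max \<noteq> {}"
    by auto
  \<comment> \<open>The degree sum, with degrees taken in all of \<open>G\<close>, breaks ties among
    maximum cliques; it is exploited by exchanging a single vertex.\<close>
  define deg where "deg K = (\<Sum>v\<in>K. card (N v))" for K
  have "Max (deg ` ?max) \<in> deg ` ?max"
    using finmax ne by (intro Max_in) auto
  then obtain K where K: "is_clique G K" "card K = m" and "deg K = Max (deg ` ?max)"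
    by auto
  then have deg_max: "deg K' \<le> deg K" if "is_clique G K'" "card K' = m" for K'
    using finmax that by auto
  have finK: "finite K"
    using K(1) pair_finite_verts finite_subset unfolding is_clique_def by blast
  have clique: "u \<sim> v" if "u \<in> K" "v \<in> K" "u \<noteq> v" for u v
    using K(1) that by (auto simp: is_clique_def)
  have nested: False if xy: "x \<sim> y" "x \<notin> K" "y \<notin> K" and sub: "\<And>u. u \<in> K \<Longrightarrow> \<not> u \<sim> x \<Longrightarrow> \<not> u \<sim> y" for x y
  proof -
    have "x \<noteq> y"
      using xy adj_irrefl by auto
    have "\<not> is_clique G (insert x K)"
      using m_ge[of "insert x K"] finK K(2) xy(2) by auto
    then obtain z where z: "z \<in> K" "\<not> z \<sim> x"
      using K(1) adj_verts[OF xy(1)] adj_sym unfolding is_clique_def by auto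
    have "\<not> z \<sim> y"
      using sub z by blast
    \<comment> \<open>A second non-neighbour \<open>u\<close> of \<open>x\<close> would also miss
      \<open>y\<close>, so the edges \<open>xy\<close> and \<open>uz\<close> would form a
      \<open>twoK2\<close>.\<close>
    have uniq: "u \<sim> x" if "u \<in> K" "u \<noteq> z" for u
      using no2K2[of x y u z] clique[OF that(1) z(1) that(2)] xy z that sub[OF that(1)] \<open>\<not> z \<sim> y\<close>
        adj_sym unfolding twoK2_def by blast
    \<comment> \<open>If \<open>z\<close> were the only vertex of \<open>K\<close> missed by
      \<open>y\<close>, trading \<open>z\<close> for \<open>x\<close> and \<open>y\<close> would
      give a clique of size \<open>m + 1\<close>. So \<open>y\<close> misses a second vertex
      \<open>u\<close>.\<close>
    have "card (insert x (insert y (K - {z}))) = Suc m"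
      using finK xy \<open>x \<noteq> y\<close> z(1) K(2) by (simp add: card_Diff_singleton) (metis Suc_pred card_gt_0_iff empty_iff)
    then have "\<not> is_clique G (insert x (insert y (K - {z})))"
      using m_ge[of "insert x (insert y (K - {z}))"] by auto
    then obtain u where u: "u \<in> K" "u \<noteq> z" "\<not> u \<sim> y"
      using K(1) adj_verts[OF xy(1)] xy(1) adj_sym uniq unfolding is_clique_def by auto
    have "is_clique G (insert x (K - {z}))"
      using K(1) adj_verts[OF xy(1)] adj_sym uniq unfolding is_clique_def by auto
    moreover have "card (insert x (K - {z})) = m"
      using finK xy z(1) K(2) by (simp add: card_Diff_singleton) (metis Suc_pred card_gt_0_iff empty_iff)
    ultimately have "deg (insert x (K - {z})) \<le> deg K"
      by (rule deg_max)
    \<comment> \<open>Exchanging \<open>z\<close> for \<open>x\<close> does not increase the degree sum, so \<open>z\<close> has a neighbour \<open>w\<close> that \<open>x\<close> lacks.\<close>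
    then have "card (N x) \<le> card (N z)"
      using finK xy z(1) by (simp add: deg_def sum.remove[of K z])
    \<comment> \<open>The inclusion would be strict because \<open>y\<close> is a neighbour of
      \<open>x\<close> but not of \<open>z\<close>.\<close>
    moreover have "card (N z) < card (N x)" if "N z \<subseteq> N x"
      using finN that xy(1) \<open>\<not> z \<sim> y\<close> by (intro psubset_card_mono) (auto simp: N_def)
    ultimately obtain w where w: "z \<sim> w" "\<not> x \<sim> w"
      by (force simp: N_def)
    \<comment> \<open>The 5-cycle \<open>x y w z u\<close> closes: the edges \<open>xy\<close> and
      \<open>zw\<close> force \<open>w \<sim> y\<close>, and then the 4-cycle \<open>u x y w\<close>
      forbids \<open>w \<sim> u\<close>.\<close>
    have "w \<sim> y"
      using no2K2[of x y z w] xy z w \<open>\<not> z \<sim> y\<close> adj_sym unfolding twoK2_def by blast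
    have "u \<noteq> y" "x \<noteq> w"
      using u xy z w by auto
    then have "\<not> w \<sim> u"
      using noC4[of u x y w] uniq[OF u(1,2)] xy w u \<open>w \<sim> y\<close> adj_sym unfolding C4_def by blast
    then have "C5 x y w z u"
      unfolding C5_def
      using uniq[OF u(1,2)] xy w u z \<open>w \<sim> y\<close> adj_sym clique[OF z(1) u(1)] \<open>\<not> z \<sim> y\<close> by blast
    then show False
      using asm by blast
  qed
  have "\<not> x \<sim> y" if outside: "x \<in> pverts G - K" "y \<in> pverts G - K" for x y
  proof
    assume xy: "x \<sim> y"
    \<comment> \<open>Applying \<open>nested\<close> in both orders gives a private neighbour of
      each end in \<open>K\<close>; the two are adjacent to each other.\<close>
    obtain u where u: "u \<in> K" "\<not> u \<sim> x" "u \<sim> y"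
      using nested[of x y] xy outside by blast
    obtain v where v: "v \<in> K" "\<not> v \<sim> y" "v \<sim> x"
      using nested[of y x] xy outside adj_sym by blast
    have "u \<noteq> v"
      using u v by blast
    then have "C4 x y u v"
      unfolding C4_def using u v xy outside clique[of u v] adj_sym by blast
    then show False
      using noC4 by blast
  qed
  then have "is_independent G (pverts G - K)"
    by (auto simp: is_independent_def)
  moreover have "K \<union> (pverts G - K) = pverts G" "K \<inter> (pverts G - K) = {}"
    using K(1) by (auto simp: is_clique_def)
  ultimately show False
    using asm K(1) unfolding split_graph_def by blast
qed

text \<open>Alternative (ii) of the theorem, phrased so that unfolding it yields the final statement
  literally.\<close>

definition C5_partition where
  "C5_partition A B C \<longleftrightarrow> A \<union> B \<union> C = pverts G \<and> A \<inter> B = {} \<and> A \<inter> C = {} \<and> B \<inter> C = {} \<and>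
    is_clique G A \<and> is_independent G B \<and> induces G C (cycle_graph 5) \<and>
    (\<forall>a\<in>A. \<forall>c\<in>C. a \<sim> c) \<and> (\<forall>b\<in>B. \<forall>c\<in>C. \<not> b \<sim> c)"

text \<open>Adjacency spreads around the cycle. A neighbour of \<open>a\<close> must see an end of
  the opposite edge \<open>cd\<close>, and a vertex seeing both neighbours of a cycle vertex must
  see that vertex as well.\<close>

lemma C5_dichotomy:
  assumes no2K2: "\<And>a b c d. \<not> twoK2 a b c d" and noC4: "\<And>a b c d. \<not> C4 a b c d"
    and "C5 a b c d e" "v \<notin> {a, b, c, d, e}" "v \<sim> a"
  shows "v \<sim> b \<and> v \<sim> c \<and> v \<sim> d \<and> v \<sim> e"
proof -
  have opposite: "v \<sim> c \<or> v \<sim> d" if "C5 a b c d e" "v \<sim> a" for a b c d e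
    using no2K2[of v a c d] that adj_sym unfolding twoK2_def C5_def by blast
  have between: "v \<sim> b" if "C5 a b c d e" "v \<sim> a" "v \<sim> c" "v \<noteq> b" for a b c d e
  proof -
    have "a \<noteq> c"
      using that(1) adj_sym unfolding C5_def by blast
    then show ?thesis
      using noC4[of v a b c] that adj_sym unfolding C4_def C5_def by blast
  qed
  note r1 = C5_rotate[OF assms(3)]
  note r2 = C5_rotate[OF r1]
  note r3 = C5_rotate[OF r2]
  note r4 = C5_rotate[OF r3]
  show ?thesis
    using assms(4,5) opposite[OF assms(3)] opposite[OF r1] opposite[OF r2] opposite[OF r3] opposite[OF r4]
      between[OF assms(3)] between[OF r1] between[OF r2] between[OF r3] between[OF r4] by blast
qed

text \<open>\<open>A\<close> and \<open>B\<close> consist of the vertices complete and anticomplete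
  to the cycle; the dichotomy, rotated through all five vertices, shows that they exhaust the rest.
  Non-adjacent vertices in \<open>A\<close> would form a \<open>C4\<close> with \<open>a\<close> and
  \<open>c\<close>, an edge in \<open>B\<close> a \<open>twoK2\<close> with
  \<open>ab\<close>.\<close>

lemma C5_partition_if_C5:
  assumes no2K2: "\<And>a b c d. \<not> twoK2 a b c d" and noC4: "\<And>a b c d. \<not> C4 a b c d"
    and C5: "C5 a b c d e"
  shows "\<exists>A B C. C5_partition A B C"
proof -
  define C where "C = {a, b, c, d, e}"
  define A where "A = {v \<in> pverts G - C. \<forall>c\<in>C. v \<sim> c}"
  define B where "B = {v \<in> pverts G - C. \<forall>c\<in>C. \<not> v \<sim> c}"
  have CV: "C \<subseteq> pverts G"
    using induces_C5I[OF C5] by (simp add: induces_def C_def)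
  note r1 = C5_rotate[OF C5]
  note r2 = C5_rotate[OF r1]
  note r3 = C5_rotate[OF r2]
  note r4 = C5_rotate[OF r3]
  note dich = C5_dichotomy[OF no2K2 noC4]
  have AB: "v \<in> A \<or> v \<in> B" if "v \<in> pverts G" "v \<notin> C" for v
    using that dich[OF C5, of v] dich[OF r1, of v] dich[OF r2, of v] dich[OF r3, of v] dich[OF r4, of v]
    unfolding A_def B_def C_def by blast
  have "a \<noteq> c"
    using C5 adj_sym unfolding C5_def by blast
  then have "u \<sim> v" if "u \<in> A" "v \<in> A" "u \<noteq> v" for u v
    using that noC4[of u a v c] C5 adj_sym unfolding A_def C_def C4_def C5_def by blast
  then have "is_clique G A"
    by (auto simp: is_clique_def A_def)
  moreover have "\<not> u \<sim> v" if "u \<in> B" "v \<in> B" for u v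
    using that no2K2[of u v a b] C5 adj_sym unfolding B_def C_def twoK2_def C5_def by blast
  then have "is_independent G B"
    by (auto simp: is_independent_def B_def)
  moreover have "A \<inter> B = {}"
    unfolding A_def B_def C_def by blast
  moreover have "A \<inter> C = {}" "B \<inter> C = {}"
    by (auto simp: A_def B_def)
  moreover have "A \<union> B \<union> C = pverts G"
    using AB CV unfolding A_def B_def by blast
  moreover have "induces G C (cycle_graph 5)"
    unfolding C_def by (rule induces_C5I[OF C5])
  moreover have "\<forall>a\<in>A. \<forall>c\<in>C. a \<sim> c" "\<forall>b\<in>B. \<forall>c\<in>C. \<not> b \<sim> c"
    by (auto simp: A_def B_def)
  ultimately show ?thesis
    unfolding C5_partition_def by blast
qed


text \<open>Every edge meets \<open>A\<close> or lies in \<open>C\<close>, and vertices of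
  \<open>A\<close> see all of \<open>A\<close> and \<open>C\<close>, so a \<open>twoK2\<close> would
  lie in \<open>C\<close>. Dually, every non-adjacent pair meets \<open>B\<close> or lies in
  \<open>C\<close>, which pushes both diagonals of a \<open>C4\<close> into \<open>C\<close>. The
  5-cycle itself contains neither.\<close>

lemma no_twoK2_C4_if_C5_partition:
  assumes "C5_partition A B C"
  shows "\<not> twoK2 p q r s" "\<not> C4 p q r s"
proof -
  obtain a b c d e where C5: "C5 a b c d e" and C: "C = {a, b, c, d, e}"
    using assms induces_C5E unfolding C5_partition_def by blast
  have V: "v \<in> A \<or> v \<in> B \<or> v \<in> C" if "v \<in> pverts G" for v
    using assms that unfolding C5_partition_def by blast
  have AA: "u = v \<or> u \<sim> v" if "u \<in> A" "v \<in> A" for u v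
    using assms that unfolding C5_partition_def is_clique_def by blast
  have AC: "u \<sim> v" if "u \<in> A" "v \<in> C" for u v
    using assms that unfolding C5_partition_def by blast
  have BB: "\<not> u \<sim> v" if "u \<in> B" "v \<in> B" for u v
    using assms that unfolding C5_partition_def is_independent_def by blast
  have BC: "\<not> u \<sim> v" if "u \<in> B" "v \<in> C" for u v
    using assms that unfolding C5_partition_def by blast
  have sym: "b \<sim> a" "c \<sim> b" "d \<sim> c" "e \<sim> d" "a \<sim> e"
      "\<not> c \<sim> a" "\<not> d \<sim> b" "\<not> e \<sim> c" "\<not> a \<sim> d" "\<not> b \<sim> e"
    using C5 adj_sym unfolding C5_def by blast+
  have irrefl: "\<not> a \<sim> a" "\<not> b \<sim> b" "\<not> c \<sim> c" "\<not> d \<sim> d" "\<not> e \<sim> e"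
    using adj_irrefl by blast+
  have C5': "a \<sim> b" "b \<sim> c" "c \<sim> d" "d \<sim> e" "e \<sim> a"
      "\<not> a \<sim> c" "\<not> b \<sim> d" "\<not> c \<sim> e" "\<not> d \<sim> a" "\<not> e \<sim> b"
    using C5 unfolding C5_def by blast+
  note adjs = C5' sym irrefl
  \<comment> \<open>A finite check on the 5-cycle; the adjacency guards come early to cut down the
    cases.\<close>
  have no2K2: "\<forall>p\<in>{a, b, c, d, e}. \<forall>q\<in>{a, b, c, d, e}. p \<sim> q \<longrightarrow>
      (\<forall>r\<in>{a, b, c, d, e}. \<forall>s\<in>{a, b, c, d, e}. r \<sim> s \<longrightarrow> p \<sim> r \<or> p \<sim> s \<or> q \<sim> r \<or> q \<sim> s)"
    by (simp add: adjs)
  have noC4: "\<forall>p\<in>{a, b, c, d, e}. \<forall>q\<in>{a, b, c, d, e}. p \<sim> q \<longrightarrow>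
      (\<forall>r\<in>{a, b, c, d, e}. q \<sim> r \<and> \<not> p \<sim> r \<longrightarrow>
        (\<forall>s\<in>{a, b, c, d, e}. r \<sim> s \<and> s \<sim> p \<longrightarrow> q \<sim> s \<or> p = r \<or> q = s))"
    by (simp add: adjs)
  show "\<not> twoK2 p q r s"
  proof
    assume *: "twoK2 p q r s"
    have edge: "p \<in> A \<or> q \<in> A \<or> p \<in> C \<and> q \<in> C" if "p \<sim> q" for p q
      using V[OF adj_verts(1)[OF that]] V[OF adj_verts(2)[OF that]] BB[of p q] BC[of p q] BC[of q p]
        adj_sym[of p q] that by blast
    have "p \<in> C \<and> q \<in> C \<and> r \<in> C \<and> s \<in> C"
      using edge[of p q] edge[of r s] AA AC * adj_sym unfolding twoK2_def by metis
    then have "p \<in> {a, b, c, d, e}" "q \<in> {a, b, c, d, e}" "r \<in> {a, b, c, d, e}" "s \<in> {a, b, c, d, e}"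
      unfolding C by blast+
    then show False
      using no2K2 * unfolding twoK2_def by blast
  qed
  show "\<not> C4 p q r s"
  proof
    assume *: "C4 p q r s"
    have nonedge: "p \<in> B \<or> q \<in> B \<or> p \<in> C \<and> q \<in> C"
      if "\<not> p \<sim> q" "p \<noteq> q" "p \<in> pverts G" "q \<in> pverts G" for p q
      using V[OF that(3)] V[OF that(4)] AA[of p q] AC[of p q] AC[of q p] adj_sym[of p q] that by blast
    have "p \<in> pverts G" "q \<in> pverts G" "r \<in> pverts G" "s \<in> pverts G"
      using * adj_verts unfolding C4_def by blast+
    then have "p \<in> C \<and> q \<in> C \<and> r \<in> C \<and> s \<in> C"
      using nonedge[of p r] nonedge[of q s] BB BC * adj_sym unfolding C4_def by metis
    then have "p \<in> {a, b, c, d, e}" "q \<in> {a, b, c, d, e}" "r \<in> {a, b, c, d, e}" "s \<in> {a, b, c, d, e}"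
      unfolding C by blast+
    then show False
      using noC4 * unfolding C4_def by blast
  qed
qed

section \<open>Edge contractions\<close>

lemma pverts_contract_edge: "pverts (contract_edge G (u, v)) = pverts G - {v}"
  by (simp add: contract_edge_def Let_def)

lemma parcs_contract_edge:
  "(x, y) \<in> parcs (contract_edge G (u, v)) \<longleftrightarrow>
    x \<noteq> v \<and> y \<noteq> v \<and> x \<noteq> y \<and> (x \<sim> y \<or> x = u \<and> v \<sim> y \<or> y = u \<and> v \<sim> x)"
  by (auto simp: contract_edge_def Let_def)

text \<open>Some end of the edge lies in the clique, so the merged vertex sees the whole remaining
  clique and can join it, whichever part \<open>u\<close> came from.\<close>

lemma split_contract_edge:
  assumes "split_graph G" "e \<in> parcs G"
  shows "split_graph (contract_edge G e)"
proof -
  obtain u v where e: "e = (u, v)" "u \<sim> v"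
    using assms(2) by (cases e) auto
  obtain A B where AB: "A \<union> B = pverts G" "A \<inter> B = {}" "is_clique G A" "is_independent G B"
    using assms(1) unfolding split_graph_def by blast
  have A: "x \<sim> y" if "x \<in> A" "y \<in> A" "x \<noteq> y" for x y
    using that AB(3) by (auto simp: is_clique_def)
  have B: "\<not> x \<sim> y" if "x \<in> B" "y \<in> B" for x y
    using that AB(4) by (auto simp: is_independent_def)
  have "u \<in> A \<or> v \<in> A"
    using e(2) B AB(1) adj_verts by blast
  have uv: "u \<in> pverts G" "u \<noteq> v"
    using e(2) adj_verts adj_irrefl by auto
  have "is_clique (contract_edge G e) (insert u (A - {v}))"
    unfolding is_clique_def e(1) pverts_contract_edge parcs_contract_edge
    using A AB(1) uv \<open>u \<in> A \<or> v \<in> A\<close> by blast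
  moreover have "is_independent (contract_edge G e) (B - {u, v})"
    unfolding is_independent_def e(1) pverts_contract_edge parcs_contract_edge
    using B AB(1) by blast
  moreover have "insert u (A - {v}) \<union> (B - {u, v}) = pverts (contract_edge G e)"
    unfolding e(1) pverts_contract_edge using AB(1) uv by blast
  moreover have "insert u (A - {v}) \<inter> (B - {u, v}) = {}"
    using AB(2) by blast
  ultimately show ?thesis
    unfolding split_graph_def by blast
qed

end

text \<open>Each of the two edges has an end in the clique, and these ends would be adjacent.
  Distinctness is explicit since \<open>H\<close> is an arbitrary record, so that contractions can
  be inserted directly.\<close>

lemma split_graph_no_twoK2:
  assumes "split_graph H" "{a, b, c, d} \<subseteq> pverts H"
    and "(a, b) \<in> parcs H" "(c, d) \<in> parcs H"
    and "a \<noteq> c" "a \<noteq> d" "b \<noteq> c" "b \<noteq> d"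
    and "(a, c) \<notin> parcs H" "(a, d) \<notin> parcs H" "(b, c) \<notin> parcs H" "(b, d) \<notin> parcs H"
  shows False
proof -
  obtain A B where AB: "A \<union> B = pverts H" "is_clique H A" "is_independent H B"
    using assms(1) unfolding split_graph_def by blast
  then have "a \<in> A \<or> b \<in> A" "c \<in> A \<or> d \<in> A"
    using assms(2-4) unfolding is_independent_def by blast+
  then show False
    using AB(2) assms(5-) unfolding is_clique_def by blast
qed

text \<open>Each diagonal has an end in the independent part, and ends of different diagonals are
  adjacent.\<close>

lemma split_graph_no_C4:
  assumes "split_graph H" "{a, b, c, d} \<subseteq> pverts H"
    and "(a, b) \<in> parcs H" "(b, c) \<in> parcs H" "(c, d) \<in> parcs H" "(d, a) \<in> parcs H"
    and "a \<noteq> c" "b \<noteq> d" "(a, c) \<notin> parcs H" "(b, d) \<notin> parcs H"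
  shows False
proof -
  obtain A B where AB: "A \<union> B = pverts H" "is_clique H A" "is_independent H B"
    using assms(1) unfolding split_graph_def by blast
  then have "a \<in> B \<or> c \<in> B" "b \<in> B \<or> d \<in> B"
    using assms(2,7-) unfolding is_clique_def by blast+
  then show False
    using AB(3) assms(3-6) unfolding is_independent_def by blast
qed

text \<open>The independent part must meet all five non-edges. These again form a 5-cycle, so it
  contains at least three of the vertices, and any three vertices of a \<open>C_5\<close> span an
  edge.\<close>

lemma split_graph_no_C5:
  assumes "split_graph H" "{a, b, c, d, e} \<subseteq> pverts H"
    and "(a, b) \<in> parcs H" "(b, c) \<in> parcs H" "(c, d) \<in> parcs H" "(d, e) \<in> parcs H" "(e, a) \<in> parcs H"
    and "a \<noteq> c" "b \<noteq> d" "c \<noteq> e" "d \<noteq> a" "e \<noteq> b"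
    and "(a, c) \<notin> parcs H" "(b, d) \<notin> parcs H" "(c, e) \<notin> parcs H" "(d, a) \<notin> parcs H" "(e, b) \<notin> parcs H"
  shows False
proof -
  obtain A B where AB: "A \<union> B = pverts H" "is_clique H A" "is_independent H B"
    using assms(1) unfolding split_graph_def by blast
  have "a \<in> B \<or> c \<in> B" "b \<in> B \<or> d \<in> B" "c \<in> B \<or> e \<in> B" "d \<in> B \<or> a \<in> B" "e \<in> B \<or> b \<in> B"
    using AB assms(2,8-) unfolding is_clique_def by blast+
  moreover have "\<not> (a \<in> B \<and> b \<in> B)" "\<not> (b \<in> B \<and> c \<in> B)" "\<not> (c \<in> B \<and> d \<in> B)"
      "\<not> (d \<in> B \<and> e \<in> B)" "\<not> (e \<in> B \<and> a \<in> B)"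
    using AB(3) assms(3-7) unfolding is_independent_def by blast+
  ultimately show False
    by blast
qed

section \<open>Graphs all of whose contractions are split\<close>

locale split_contractions = pair_graph +
  assumes connected: "connected (with_proj G)"
    and split_contract: "e \<in> parcs G \<Longrightarrow> split_graph (contract_edge G e)"
begin

text \<open>Connectedness in the form used below: with a singleton it excludes isolated vertices,
  with \<open>{a, b}\<close> it yields a vertex attached to an edge.\<close>

lemma edge_leaving:
  assumes "x \<in> X" "y \<in> pverts G - X" "X \<subseteq> pverts G"
  obtains u v where "u \<in> X" "v \<in> pverts G - X" "u \<sim> v"
proof -
  have "(x, y) \<in> rtrancl_on (pverts G) (symcl (parcs G))"
    using connected assms by (auto simp: connected_conv)
  then have "y \<in> X \<or> (\<exists>u\<in>X. \<exists>v\<in>pverts G - X. u \<sim> v)"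
  proof (induction rule: rtrancl_on_induct)
    case base
    then show ?case using assms(1) by blast
  next
    case (step u v)
    then have "u \<sim> v"
      by (auto simp: symcl_def adj_sym)
    then show ?case
      using step adj_verts by blast
  qed
  then show thesis
    using assms(2) that by blast
qed

lemma twoK2_disjoint_edge:
  assumes "twoK2 a b c d" "x \<sim> y" "x \<notin> {a, b, c, d}" "y \<notin> {a, b, c, d}"
  shows False
proof (rule split_graph_no_twoK2[OF split_contract[OF assms(2)], of a b c d])
  show "{a, b, c, d} \<subseteq> pverts (contract_edge G (x, y))"
    using assms adj_verts unfolding pverts_contract_edge twoK2_def by blast
qed (use assms adj_irrefl adj_sym in \<open>auto simp: parcs_contract_edge twoK2_def\<close>)

text \<open>Contracting \<open>(a, w)\<close> keeps \<open>a\<close> and hands it the neighbours of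
  \<open>w\<close>. If \<open>w\<close> saw neither \<open>c\<close> nor \<open>d\<close>, the
  \<open>twoK2\<close> would survive.\<close>

lemma twoK2_neighbour:
  assumes "twoK2 a b c d" "w \<sim> a" "w \<noteq> b"
  shows "w \<sim> c \<or> w \<sim> d"
proof (rule ccontr)
  assume non: "\<not> ?thesis"
  have aw: "a \<sim> w"
    using assms(2) adj_sym by blast
  have w: "w \<notin> {a, b, c, d}"
    using assms adj_irrefl adj_sym unfolding twoK2_def by blast
  show False
  proof (rule split_graph_no_twoK2[OF split_contract[OF aw], of a b c d])
    show "{a, b, c, d} \<subseteq> pverts (contract_edge G (a, w))"
      using assms w adj_verts unfolding pverts_contract_edge twoK2_def by blast
  qed (use assms w non adj_irrefl adj_sym in \<open>auto simp: parcs_contract_edge twoK2_def\<close>)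
qed

lemma C4_disjoint_edge:
  assumes "C4 a b c d" "x \<sim> y" "x \<notin> {a, b, c, d}" "y \<notin> {a, b, c, d}"
  shows False
proof (rule split_graph_no_C4[OF split_contract[OF assms(2)], of a b c d])
  show "{a, b, c, d} \<subseteq> pverts (contract_edge G (x, y))"
    using assms adj_verts unfolding pverts_contract_edge C4_def by blast
qed (use assms adj_irrefl in \<open>auto simp: parcs_contract_edge C4_def\<close>)

lemma C4_rotate: "C4 a b c d \<Longrightarrow> C4 b c d a"
  by (auto simp: C4_def adj_sym)

text \<open>Contracting \<open>(a, w)\<close> could destroy the 4-cycle only by creating the chord
  \<open>ac\<close>; further edges from \<open>w\<close> to \<open>b\<close> or \<open>d\<close>
  merely duplicate edges at \<open>a\<close>.\<close>

lemma C4_neighbour: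
  assumes "C4 a b c d" "w \<sim> a" "w \<notin> {b, d}"
  shows "w \<sim> c"
proof (rule ccontr)
  assume non: "\<not> w \<sim> c"
  have aw: "a \<sim> w"
    using assms(2) adj_sym by blast
  have w: "w \<notin> {a, b, c, d}"
    using assms adj_irrefl adj_sym unfolding C4_def by blast
  show False
  proof (rule split_graph_no_C4[OF split_contract[OF aw], of a b c d])
    show "{a, b, c, d} \<subseteq> pverts (contract_edge G (a, w))"
      using assms w adj_verts unfolding pverts_contract_edge C4_def by blast
  qed (use assms w non adj_irrefl in \<open>auto simp: parcs_contract_edge C4_def\<close>)
qed


lemma twoK2_swap: "twoK2 a b c d \<Longrightarrow> twoK2 b a c d" "twoK2 a b c d \<Longrightarrow> twoK2 c d a b"
  by (auto simp: twoK2_def adj_sym)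

lemma twoK2_exceptional:
  assumes "twoK2 a b c d"
  shows "graph_iso G (path_graph 5) \<or> graph_iso G hammer \<or> graph_iso G butterfly"
proof -
  let ?S = "{a, b, c, d}"
  have S: "?S \<subseteq> pverts G"
    using assms adj_verts unfolding twoK2_def by blast
  have ne: "a \<noteq> b" "a \<noteq> c" "a \<noteq> d" "b \<noteq> c" "b \<noteq> d" "c \<noteq> d"
    using assms adj_irrefl adj_sym unfolding twoK2_def by metis+
  have nbr: "(w \<sim> a \<or> w \<sim> b) \<longleftrightarrow> (w \<sim> c \<or> w \<sim> d)" if "w \<notin> ?S" for w
    using twoK2_neighbour[OF assms, of w] twoK2_neighbour[OF twoK2_swap(1)[OF assms], of w]
      twoK2_neighbour[OF twoK2_swap(2)[OF assms], of w]
      twoK2_neighbour[OF twoK2_swap(1)[OF twoK2_swap(2)[OF assms]], of w] that by blast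
  have nbrs: "(w \<sim> a \<or> w \<sim> b) \<and> (w \<sim> c \<or> w \<sim> d)" if w: "w \<in> pverts G - ?S" for w
  proof -
    obtain v where "v \<in> pverts G" "w \<sim> v"
      using edge_leaving[of w "{w}" a] w S by blast
    then have "v \<in> ?S"
      using twoK2_disjoint_edge[OF assms, of w v] w by blast
    then show ?thesis
      using nbr[of w] w \<open>w \<sim> v\<close> by blast
  qed
  have uniq: "w = w'" if w: "w \<in> pverts G - ?S" and w': "w' \<in> pverts G - ?S" for w w'
  proof (rule ccontr)
    assume "w \<noteq> w'"
    have ww': "\<not> w \<sim> w'"
      using twoK2_disjoint_edge[OF assms, of w w'] w w' by blast
    have ab: "a \<sim> b"
      using assms by (simp add: twoK2_def)
    \<comment> \<open>Each outside vertex sees \<open>a\<close> or \<open>b\<close>, so in this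
      contraction \<open>w\<close> and \<open>w'\<close> both see the merged vertex
      \<open>a\<close>, while \<open>c\<close> and \<open>d\<close> still do not.\<close>
    let ?H = "contract_edge G (a, b)"
    have H: "?S - {b} \<union> {w, w'} \<subseteq> pverts ?H"
      using S w w' unfolding pverts_contract_edge by blast
    have aw: "(a, w) \<in> parcs ?H" "(w', a) \<in> parcs ?H"
      using nbrs[OF w] nbrs[OF w'] w w' ne(1) adj_sym unfolding parcs_contract_edge by blast+
    have nww': "(w, w') \<notin> parcs ?H" "(w', w) \<notin> parcs ?H"
      using ww' w w' adj_sym unfolding parcs_contract_edge by blast+
    have nac: "(a, x) \<notin> parcs ?H" "(x, a) \<notin> parcs ?H" if "x \<in> {c, d}" for x
      using that assms ne adj_sym unfolding parcs_contract_edge twoK2_def by blast+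
    have arc: "(x, y) \<in> parcs ?H \<longleftrightarrow> x \<sim> y" if "x \<in> {c, d, w, w'}" "y \<in> {c, d, w, w'}" for x y
      using that w w' ne adj_irrefl unfolding parcs_contract_edge by blast
    \<comment> \<open>In the contraction, \<open>w\<close> and \<open>w'\<close> close a \<open>C\<^sub>4\<close> through a common neighbour among \<open>c\<close>, \<open>d\<close>, or else a \<open>C\<^sub>5\<close>.\<close>
    have no_common: False if x: "x \<in> {c, d}" "w \<sim> x" "w' \<sim> x" for x
    proof (rule split_graph_no_C4[OF split_contract[OF ab], of a w x w'])
      show "{a, w, x, w'} \<subseteq> pverts ?H"
        using H ne x(1) by blast
      show "(w, x) \<in> parcs ?H" "(x, w') \<in> parcs ?H"
        using arc[of w x] arc[of x w'] x adj_sym by blast+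
      show "a \<noteq> x"
        using x ne by blast
    qed (use aw nww' nac x \<open>w \<noteq> w'\<close> in auto)
    have no_path: False if xy: "x \<in> {c, d}" "y \<in> {c, d}" "x \<sim> y" "w \<sim> x" "w' \<sim> y" for x y
    proof -
      have "\<not> w \<sim> y" "\<not> w' \<sim> x"
        using no_common xy by blast+
      moreover have "x \<noteq> y"
        using xy adj_irrefl by blast
      ultimately show False
        using split_graph_no_C5[OF split_contract[OF ab], of a w x y w'] H aw nac[OF xy(1)] nac[OF xy(2)] nww'
          arc[of w x] arc[of x y] arc[of y w'] arc[of w y] arc[of x w'] xy w w' adj_sym[of y w'] adj_sym[of x w']
          \<open>w \<noteq> w'\<close> ne by blast
    qed
    have "c \<sim> d" "d \<sim> c"
      using assms adj_sym by (simp_all add: twoK2_def)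
    then show False
      using nbrs[OF w] nbrs[OF w'] no_common no_path by blast
  qed
  \<comment> \<open>Existence of an outside vertex: an edge leaving \<open>{a, b}\<close> cannot end
    in \<open>c\<close> or \<open>d\<close>.\<close>
  obtain u w where u: "u \<in> {a, b}" and w: "w \<in> pverts G - {a, b}" "u \<sim> w"
    using edge_leaving[of a "{a, b}" c] S ne by blast
  have wS: "w \<in> pverts G - ?S"
    using assms u w unfolding twoK2_def by blast
  have V: "pverts G = {a, b, c, d, w}"
    using S wS uniq[OF wS] by blast
  \<comment> \<open>Stated for fresh names, so that swapping the ends of either edge reduces to
    \<open>w \<sim> a\<close> and \<open>w \<sim> c\<close>. Adjacency of \<open>w\<close> to
    \<open>b\<close> and \<open>d\<close> then selects the graph.\<close>
  have iso: ?thesis if K: "twoK2 a b c d" and V: "pverts G = {a, b, c, d, w}"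
    and ne: "distinct [a, b, c, d, w]" and w: "w \<sim> a" "w \<sim> c" for a b c d
  proof -
    have sym: "a \<sim> b" "b \<sim> a" "c \<sim> d" "d \<sim> c" "a \<sim> w" "c \<sim> w"
      "\<not> a \<sim> c" "\<not> a \<sim> d" "\<not> b \<sim> c" "\<not> b \<sim> d" "\<not> c \<sim> a" "\<not> d \<sim> a" "\<not> c \<sim> b" "\<not> d \<sim> b"
      "b \<sim> w \<longleftrightarrow> w \<sim> b" "d \<sim> w \<longleftrightarrow> w \<sim> d"
      using K w adj_sym unfolding twoK2_def by blast+
    consider "\<not> w \<sim> b" "\<not> w \<sim> d" | "w \<sim> b" "\<not> w \<sim> d" | "\<not> w \<sim> b" "w \<sim> d" | "w \<sim> b" "w \<sim> d"
      by blast
    then show ?thesis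
    proof cases
      case 1
      have "induces G (set [b, a, w, c, d]) (path_graph 5)"
        by (rule induces_set_listI[OF _ path_graph_pair_graph])
          (use V ne w sym 1 in \<open>auto simp: path_graph_simps numeral_eq_Suc All_less_Suc\<close>)
      moreover have "set [b, a, w, c, d] = pverts G"
        unfolding V by auto
      ultimately show ?thesis
        using graph_iso_if_induces by metis
    next
      case 2
      have "induces G (set [d, c, w, a, b]) hammer"
        by (rule induces_set_listI[OF _ hammer_pair_graph])
          (use V ne w sym 2 in \<open>auto simp: hammer_def graph_of_edges_def numeral_eq_Suc All_less_Suc\<close>)
      moreover have "set [d, c, w, a, b] = pverts G"
        unfolding V by auto
      ultimately show ?thesis
        using graph_iso_if_induces by metis
    next
      case 3
      have "induces G (set [b, a, w, c, d]) hammer"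
        by (rule induces_set_listI[OF _ hammer_pair_graph])
          (use V ne w sym 3 in \<open>auto simp: hammer_def graph_of_edges_def numeral_eq_Suc All_less_Suc\<close>)
      moreover have "set [b, a, w, c, d] = pverts G"
        unfolding V by auto
      ultimately show ?thesis
        using graph_iso_if_induces by metis
    next
      case 4
      have "induces G (set [a, b, w, c, d]) butterfly"
        by (rule induces_set_listI[OF _ butterfly_pair_graph])
          (use V ne w sym 4 in \<open>auto simp: butterfly_def graph_of_edges_def numeral_eq_Suc All_less_Suc\<close>)
      moreover have "set [a, b, w, c, d] = pverts G"
        unfolding V by auto
      ultimately show ?thesis
        using graph_iso_if_induces by metis
    qed
  qed
  have K: "twoK2 b a c d" "twoK2 a b d c" "twoK2 b a d c"
    using assms by (auto simp: twoK2_def adj_sym)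
  have V': "pverts G = {b, a, c, d, w}" "pverts G = {a, b, d, c, w}" "pverts G = {b, a, d, c, w}"
    unfolding V by blast+
  consider "w \<sim> a" "w \<sim> c" | "w \<sim> b" "w \<sim> c" | "w \<sim> a" "w \<sim> d" | "w \<sim> b" "w \<sim> d"
    using nbrs[OF wS] by blast
  then show ?thesis
    using iso[OF assms V] iso[OF K(1) V'(1)] iso[OF K(2) V'(2)] iso[OF K(3) V'(3)] ne wS
    by cases auto
qed

text \<open>By \<open>C4_neighbour\<close>, \<open>w\<close> sees \<open>a\<close> and
  \<open>c\<close> only, and \<open>w'\<close> sees \<open>b\<close> and \<open>d\<close>. If
  \<open>w'\<close> also sees \<open>a\<close>, the edge \<open>bw'\<close> avoids the 4-cycle
  \<open>w a d c\<close>; otherwise the edge \<open>wa\<close> avoids the 4-cycle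
  \<open>b c d w'\<close>.\<close>

lemma C4_no_mixed_neighbours:
  assumes "C4 a b c d" and w: "w \<notin> {a, b, c, d}" "w \<sim> a" "\<not> w \<sim> b"
    and w': "w' \<notin> {a, b, c, d}" "w' \<sim> b"
  shows False
proof -
  have "a \<noteq> b" "b \<noteq> c" "c \<noteq> d" "d \<noteq> a"
    using assms(1) adj_irrefl unfolding C4_def by blast+
  have C4: "a \<sim> b" "b \<sim> c" "c \<sim> d" "d \<sim> a" "\<not> a \<sim> c" "\<not> b \<sim> d" "a \<noteq> c" "b \<noteq> d" "a \<sim> d"
    using assms(1) adj_sym unfolding C4_def by blast+
  have wc: "w \<sim> c" "c \<sim> w"
    using C4_neighbour[OF assms(1)] w adj_sym by blast+
  have wd: "\<not> w \<sim> d"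
    using C4_neighbour[of d a b c w] C4_rotate[OF C4_rotate[OF C4_rotate[OF assms(1)]]] w by blast
  have w'd: "w' \<sim> d" "d \<sim> w'"
    using C4_neighbour[OF C4_rotate[OF assms(1)]] w' adj_sym by blast+
  show False
  proof (cases "w' \<sim> a")
    case True
    have "C4 w a d c"
      unfolding C4_def using C4 w wc wd adj_sym by blast
    then show False
      using C4_disjoint_edge[of w a d c b w'] w w' \<open>a \<noteq> b\<close> \<open>b \<noteq> c\<close> C4 adj_sym by blast
  next
    case False
    then have "\<not> c \<sim> w'"
      using C4_neighbour[OF C4_rotate[OF C4_rotate[OF assms(1)]], of w'] w' adj_sym by blast
    then have "C4 b c d w'"
      unfolding C4_def using C4 w' w'd by blast
    then show False
      using C4_disjoint_edge[of b c d w' w a] w w' False C4 \<open>a \<noteq> b\<close> \<open>d \<noteq> a\<close> by blast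
  qed
qed

text \<open>Outside vertices miss \<open>b\<close>, hence \<open>d\<close>; being pairwise
  non-adjacent but not isolated, they see both \<open>a\<close> and \<open>c\<close>. So
  \<open>{a, c}\<close> is one part and all other vertices, among them \<open>b\<close> and
  \<open>d\<close>, form the other.\<close>

lemma C4_complete_bipartite:
  assumes "C4 a b c d" and no_b: "\<And>w. w \<in> pverts G - {a, b, c, d} \<Longrightarrow> \<not> w \<sim> b"
  shows "\<exists>l\<ge>2. complete_bipartite_digraph 2 l (with_proj G)"
proof -
  let ?S = "{a, b, c, d}"
  define W where "W = pverts G - {a, c}"
  have C4: "a \<sim> b" "b \<sim> c" "c \<sim> d" "d \<sim> a" "\<not> a \<sim> c" "\<not> b \<sim> d" "a \<noteq> c" "b \<noteq> d"
      "b \<sim> a" "d \<sim> c" "\<not> c \<sim> a" "\<not> d \<sim> b" "\<not> b \<sim> b" "\<not> d \<sim> d" "\<not> a \<sim> a" "\<not> c \<sim> c"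
    using assms(1) adj_sym adj_irrefl unfolding C4_def by blast+
  have S: "?S \<subseteq> pverts G"
    using C4 adj_verts by blast
  have no_d: "\<not> w \<sim> d" if "w \<in> pverts G - ?S" for w
    using C4_neighbour[of d a b c w] C4_rotate[OF C4_rotate[OF C4_rotate[OF assms(1)]]] that no_b[OF that] by blast
  have indep: "\<not> w \<sim> w'" if "w \<in> pverts G - ?S" "w' \<in> pverts G - ?S" for w w'
    using C4_disjoint_edge[OF assms(1), of w w'] that by blast
  have to_ac: "w \<sim> a \<and> w \<sim> c" if w: "w \<in> pverts G - ?S" for w
  proof -
    obtain v where "v \<in> pverts G" "w \<sim> v"
      using edge_leaving[of w "{w}" a] w S by blast
    then have "w \<sim> a \<or> w \<sim> c"
      using indep[OF w, of v] no_b[OF w] no_d[OF w] by blast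
    then show ?thesis
      using C4_neighbour[OF assms(1), of w] C4_neighbour[OF C4_rotate[OF C4_rotate[OF assms(1)]], of w] w by blast
  qed
  have W1: "w \<sim> a \<and> w \<sim> c" if "w \<in> W" for w
    using that to_ac[of w] C4 unfolding W_def by blast
  have W2: "\<not> w \<sim> w'" if "w \<in> W" "w' \<in> W" for w w'
    using that indep[of w w'] no_b[of w] no_b[of w'] no_d[of w] no_d[of w'] C4 adj_sym[of w w']
    unfolding W_def by blast
  have "(x, y) \<in> parcs G \<longleftrightarrow> (x, y) \<in> {a, c} \<times> W \<union> W \<times> {a, c}" for x y
  proof
    assume "x \<sim> y"
    then show "(x, y) \<in> {a, c} \<times> W \<union> W \<times> {a, c}"
      using W2[of x y] adj_verts[of x y] C4 unfolding W_def by blast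
  next
    assume "(x, y) \<in> {a, c} \<times> W \<union> W \<times> {a, c}"
    then show "x \<sim> y"
      using W1[of x] W1[of y] adj_sym[of x y] by blast
  qed
  then have "parcs G = {a, c} \<times> W \<union> W \<times> {a, c}"
    by auto
  moreover have "pverts G = {a, c} \<union> W" "{a, c} \<inter> W = {}" "card {a, c} = 2"
    using S C4 by (auto simp: W_def)
  ultimately have "complete_bipartite_digraph 2 (card W) (with_proj G)"
    unfolding complete_bipartite_digraph_pair_def using pair_finite_verts by blast
  moreover have "{b, d} \<subseteq> W"
    using S C4 unfolding W_def by blast
  then have "card {b, d} \<le> card W"
    using pair_finite_verts by (intro card_mono) (auto simp: W_def)
  then have "2 \<le> card W"
    using C4 by simp
  ultimately show ?thesis
    by blast
qed

lemma C4_exceptional: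
  assumes "C4 a b c d"
  shows "(\<exists>l\<ge>2. complete_bipartite_digraph 2 l (with_proj G)) \<or> graph_iso G wheel4 \<or>
    graph_iso G (graph_join (edgeless_graph 2) (cycle_graph 4))"
proof -
  let ?S = "{a, b, c, d}"
  define O' where "O' = pverts G - ?S"
  have S: "?S \<subseteq> pverts G"
    using assms adj_verts unfolding C4_def by blast
  note r1 = C4_rotate[OF assms]
  note r2 = C4_rotate[OF r1]
  note r3 = C4_rotate[OF r2]
  have ac: "w \<sim> a \<longleftrightarrow> w \<sim> c" and bd: "w \<sim> b \<longleftrightarrow> w \<sim> d" if "w \<in> O'" for w
    using C4_neighbour[OF assms, of w] C4_neighbour[OF r1, of w] C4_neighbour[OF r2, of w]
      C4_neighbour[OF r3, of w] that unfolding O'_def by blast+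
  have indep: "\<not> w \<sim> w'" if "w \<in> O'" "w' \<in> O'" for w w'
    using C4_disjoint_edge[OF assms, of w w'] that unfolding O'_def by blast
  have nbr: "w \<sim> a \<or> w \<sim> b" if w: "w \<in> O'" for w
  proof -
    obtain v where "v \<in> pverts G" "w \<sim> v"
      using edge_leaving[of w "{w}" a] w S unfolding O'_def by blast
    then show ?thesis
      using indep[OF w, of v] ac[OF w] bd[OF w] unfolding O'_def by blast
  qed
  \<comment> \<open>The first case includes an empty \<open>O'\<close>, where \<open>G\<close> is
    the 4-cycle, that is \<open>K_{2,2}\<close>.\<close>
  consider "\<forall>w\<in>O'. \<not> w \<sim> b" | w where "w \<in> O'" "\<not> w \<sim> a"
    | w where "w \<in> O'" "w \<sim> b" "\<forall>w\<in>O'. w \<sim> a"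
    by blast
  then show ?thesis
  proof cases
    case 1
    then show ?thesis
      using C4_complete_bipartite[OF assms] unfolding O'_def by blast
  next
    case 2
    \<comment> \<open>As \<open>w\<close> misses \<open>a\<close>, it sees \<open>b\<close> and
      misses \<open>c\<close>. On the rotated cycle no outside vertex can then see \<open>c\<close>,
      so \<open>{b, d}\<close> becomes the part of size two.\<close>
    have "\<not> w' \<sim> c" if "w' \<in> O'" for w'
      using C4_no_mixed_neighbours[OF r1, of w w'] nbr[OF 2(1)] 2 ac[OF 2(1)] that
      unfolding O'_def by blast
    then show ?thesis
      using C4_complete_bipartite[OF r1] unfolding O'_def by blast
  next
    case 3
    have all: "w' \<sim> a \<and> w' \<sim> b" if "w' \<in> O'" for w'
      using C4_no_mixed_neighbours[OF assms, of w' w] 3 that unfolding O'_def by blast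
    have full: "u \<sim> v" if "u \<in> O'" "v \<in> ?S" for u v
      using that all[OF that(1)] ac[OF that(1)] bd[OF that(1)] by blast
    have join: "graph_iso G (graph_join (edgeless_graph (length xs)) (cycle_graph 4))"
      if "distinct xs" "set xs = O'" for xs
    proof (rule graph_iso_join_edgeless_C4[OF assms that(1)])
      show "set xs \<inter> ?S = {}" "pverts G = set xs \<union> ?S"
        using that(2) S unfolding O'_def by blast+
      show "\<not> u \<sim> v" if "u \<in> set xs" "v \<in> set xs" for u v
        using that \<open>set xs = O'\<close> indep by blast
      show "u \<sim> v" if "u \<in> set xs" "v \<in> ?S" for u v
        using that \<open>set xs = O'\<close> full by blast
    qed
    show ?thesis
    proof (cases "O' = {w}")
      case True
      have "complete_graph 1 = edgeless_graph 1"
        by (auto simp: complete_graph_def edgeless_graph_def graph_of_edges_def)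
      then have "graph_iso G wheel4"
        using join[of "[w]"] True by (simp add: wheel4_def)
      then show ?thesis by blast
    next
      case False
      then obtain w' where w': "w' \<in> O'" "w' \<noteq> w"
        using 3(1) by blast
      \<comment> \<open>This second 4-cycle bounds the number of outside vertices by two: a third
        one, \<open>x\<close>, would give the edge \<open>xa\<close> disjoint from it.\<close>
      have C4': "C4 b w d w'"
        unfolding C4_def using full[OF 3(1)] full[OF w'(1)] w'(2) indep[OF 3(1) w'(1)] assms adj_sym
        unfolding C4_def by blast
      have "x = w \<or> x = w'" if "x \<in> O'" for x
      proof (rule ccontr)
        assume "\<not> ?thesis"
        moreover have "a \<noteq> b" "a \<noteq> d"
          using assms adj_irrefl unfolding C4_def by blast+
        ultimately show False
          using C4_disjoint_edge[OF C4', of x a] full[OF that, of a] that 3(1) w' unfolding O'_def by blast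
      qed
      then have "set [w, w'] = O'"
        using 3(1) w'(1) by auto
      then show ?thesis
        using join[of "[w, w']"] w'(2) by (simp add: numeral_2_eq_2)
    qed
  qed
qed

end

theorem theorem4p4:
  fixes G :: "'a pair_pre_digraph"
  assumes "pair_graph G"
    and "Digraph_Component.connected (with_proj G)"
    and "\<forall>l\<ge>2. \<not> complete_bipartite_digraph 2 l (with_proj G)"
    and "\<not> graph_iso G wheel4"
    and "\<not> graph_iso G (graph_join (edgeless_graph 2) (cycle_graph 4))"
    and "\<not> graph_iso G two_K2"
    and "\<not> graph_iso G (path_graph 5)"
    and "\<not> graph_iso G hammer"
    and "\<not> graph_iso G butterfly"
  shows "pseudo_split G \<longleftrightarrow>
    (\<forall>e\<in>parcs G. split_graph (contract_edge G e)) \<or>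
    (\<exists>A B C. A \<union> B \<union> C = pverts G \<and> A \<inter> B = {} \<and> A \<inter> C = {} \<and> B \<inter> C = {} \<and>
       is_clique G A \<and> is_independent G B \<and> induces G C (cycle_graph 5) \<and>
       (\<forall>a\<in>A. \<forall>c\<in>C. (a, c) \<in> parcs G) \<and>
       (\<forall>b\<in>B. \<forall>c\<in>C. (b, c) \<notin> parcs G))"
proof -
  interpret pair_graph G by fact
  have pseudo_split: "pseudo_split G \<longleftrightarrow> (\<forall>a b c d. \<not> twoK2 a b c d) \<and> (\<forall>a b c d. \<not> C4 a b c d)"
    unfolding pseudo_split_def induces_two_K2_iff induces_C4_iff by blast
  have "pseudo_split G \<longleftrightarrow>
      (\<forall>e\<in>parcs G. split_graph (contract_edge G e)) \<or> (\<exists>A B C. C5_partition A B C)"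
  proof
    assume "pseudo_split G"
    then have free: "\<not> twoK2 a b c d" "\<not> C4 a b c d" for a b c d
      unfolding pseudo_split by blast+
    \<comment> \<open>A split \<open>G\<close> has split contractions, which is (i); otherwise there
      is a \<open>C5\<close>, which gives (ii).\<close>
    show "(\<forall>e\<in>parcs G. split_graph (contract_edge G e)) \<or> (\<exists>A B C. C5_partition A B C)"
      using split_or_C5[OF free] split_contract_edge C5_partition_if_C5[OF free] by blast
  next
    assume "(\<forall>e\<in>parcs G. split_graph (contract_edge G e)) \<or> (\<exists>A B C. C5_partition A B C)"
    then show "pseudo_split G"
    proof
      assume "\<forall>e\<in>parcs G. split_graph (contract_edge G e)"
      then interpret split_contractions G
        using assms(2) by unfold_locales auto
      show ?thesis
        unfolding pseudo_split using twoK2_exceptional C4_exceptional assms(3-) by blast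
    next
      assume "\<exists>A B C. C5_partition A B C"
      then show ?thesis
        unfolding pseudo_split using no_twoK2_C4_if_C5_partition by blast
    qed
  qed
  then show ?thesis
    unfolding C5_partition_def .
qed

end
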